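(* As $n\to\infty$, $$k_0(n,4,n)\le \frac{3}{\lg(81/75)}\,(1+o(1))\lg n\qquad\text{and}\qquad k_0(n,4,4)\le \frac{3}{\lg(256/244)}\,(1+o(1))\lg n ,$$ where $3/\lg(81/75)=27.019\ldots$ and $3/\lg(256/244)=43.313\ldots$.
   Context: $\lg$ denotes $\log_2$. For a positive integer $t$, $[t]=\{1,\dots,t\}$. A word $w=w_1\cdots w_t$ of length $t$ over an alphabet induces the partition of $[t]$ in which $i$ and $j$ are in the same block iff $w_i=w_j$; two words are equivalent if they induce the same partition. For $n\ge t$, a $k\times n$ array with entries from the alphabet $\{1,\dots,d\}$ (or any $d$-letter alphabet) is a covering array for set partitions (with parameters $t,d$) if for each choice of $t$ columns, each of the $B(t)$ partitions of $[t]$ (into any number of parts, $B(t)$ being the Bell number) is induced by the word appearing in at least one of the rows of the selected $t$ columns (the columns being taken in their order from left to right). $k_0(n,t,d)$ denotes the minimum number $k$ of rows for which such a $k\times n$ array exists. In $k_0(n,4,n)$ the alphabet size equals the number $n$ of columns. The term $o(1)$ denotes a quantity tending to $0$ as $n\to\infty$. *)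

theory Defs
  imports Complex_Main "HOL-Library.Disjoint_Sets"
begin

text \<open>A word of length \<open>t\<close> is a function on positions, of which only the values on \<open>{1..t}\<close> matter.\<close>

definition induced_partition :: "nat \<Rightarrow> (nat \<Rightarrow> 'a) \<Rightarrow> nat set set" where
  "induced_partition t w = (\<lambda>i. {j \<in> {1..t}. w j = w i}) ` {1..t}"

text \<open>
  A \<open>k \<times> n\<close> array is a function \<open>A\<close> with \<open>A r c\<close> the entry in row \<open>r \<in> {1..k}\<close> and column
  \<open>c \<in> {1..n}\<close>. A choice of \<open>t\<close> columns, taken from left to right, is a strictly increasing map
  \<open>{1..t} \<rightarrow> {1..n}\<close>.
\<close>

definition covering_array_set_partitions ::
  "nat \<Rightarrow> nat \<Rightarrow> nat \<Rightarrow> nat \<Rightarrow> (nat \<Rightarrow> nat \<Rightarrow> nat) \<Rightarrow> bool" where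
  "covering_array_set_partitions k n t d A \<longleftrightarrow>
     (\<forall>r\<in>{1..k}. \<forall>c\<in>{1..n}. A r c \<in> {1..d}) \<and>
     (\<forall>s. strict_mono_on {1..t} s \<and> s ` {1..t} \<subseteq> {1..n} \<longrightarrow>
        (\<forall>P. partition_on {1..t} P \<longrightarrow>
           (\<exists>r\<in>{1..k}. induced_partition t (\<lambda>j. A r (s j)) = P)))"

text \<open>
  Meaningful for \<open>1 \<le> t \<le> n\<close> and \<open>t \<le> d\<close>: if \<open>d < t \<le> n\<close>, no covering array exists and the value
  of \<open>LEAST\<close> is unspecified.
\<close>

definition k0 :: "nat \<Rightarrow> nat \<Rightarrow> nat \<Rightarrow> nat" where
  "k0 n t d = (LEAST k. \<exists>A. covering_array_set_partitions k n t d A)"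

end

theory Submission
  imports Defs "HOL-Library.FuncSet" "HOL-Analysis.Harmonic_Numbers"
begin

text \<open>
  The proof is the deletion method. Choose a \<open>k \<times> 2n\<close> array uniformly at random over a small alphabet
  of \<open>q\<close> letters. A partition of four positions into \<open>b\<close> blocks is induced by \<open>q (q - 1) \<dots> (q - b + 1)\<close>
  of the \<open>q ^ 4\<close> words, because such a word is the same thing as an injective labelling of the blocks.
  For \<open>2 \<le> b \<le> q\<close> this is at least \<open>q (q - 1)\<close>, so a fixed choice of four columns misses a fixed
  partition in all \<open>k\<close> rows with probability at most \<open>p ^ k\<close>, where \<open>p = 1 - q (q - 1) / q ^ 4\<close>; this is
  \<open>75/81\<close> for \<open>q = 3\<close> and \<open>244/256\<close> for \<open>q = 4\<close>.

  The expected number of misses is at most \<open>F (2n) ^ 4 p ^ k\<close>, with \<open>F\<close> the number of partitions. It does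
  not exceed \<open>n\<close> as soon as \<open>16 F n ^ 3 p ^ k \<le> 1\<close>. Some array then has at most \<open>n\<close> misses, and deleting one
  column from each of them leaves \<open>n\<close> columns without any miss
  (\<open>exists_covering_by_deletion\<close>). Doubling the columns and paying \<open>n\<close> of them is what
  lowers the exponent of \<open>n\<close> from \<open>4\<close>, which a plain union bound gives, to \<open>3\<close>. Hence
  \<open>k = 3 lg n / lg (1/p) + O(1)\<close> rows suffice.

  The partitions left out cost \<open>O(1)\<close> further rows (\<open>covers_add_row\<close>): a constant row induces the
  one-block partition everywhere, and, when there are \<open>n\<close> letters, a row without repetitions
  induces the partition into singletons. The second row is what makes the choice \<open>q = 3\<close> possible
  for the alphabet of size \<open>n\<close>; with four letters all partitions into two, three or four blocks
  have to come from the random rows.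

  Probabilities are expressed by counting arrays, as extensional functions.
\<close>

section \<open>Words inducing a given partition\<close>

definition block :: "'a set set \<Rightarrow> 'a \<Rightarrow> 'a set" where
  "block P i = (THE X. X \<in> P \<and> i \<in> X)"

lemma block_eqI:
  assumes "partition_on A P" "X \<in> P" "i \<in> X"
  shows "block P i = X"
  unfolding block_def
proof (rule the_equality)
  fix Y assume "Y \<in> P \<and> i \<in> Y"
  then show "Y = X"
    using assms partition_onD2[OF assms(1)] by (auto simp: disjoint_def)
qed (use assms in auto)

lemma block_mem:
  assumes "partition_on A P" "i \<in> A"
  shows "block P i \<in> P" "i \<in> block P i"
proof -
  obtain X where "X \<in> P" "i \<in> X"
    using assms partition_onD1[OF assms(1)] by auto
  then show "block P i \<in> P" "i \<in> block P i"
    using block_eqI[OF assms(1)] by auto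
qed

lemma block_image:
  assumes "partition_on A P"
  shows "block P ` A = P"
proof
  show "block P ` A \<subseteq> P" using block_mem[OF assms] by auto
  show "P \<subseteq> block P ` A"
  proof
    fix X assume X: "X \<in> P"
    then obtain i where "i \<in> X" using partition_onD3[OF assms] by (metis ex_in_conv)
    then show "X \<in> block P ` A"
      using X block_eqI[OF assms X] partition_onD1[OF assms] by (intro image_eqI[of _ _ i]) auto
  qed
qed

lemma induced_partition_cong:
  assumes "\<And>j. j \<in> {1..t} \<Longrightarrow> v j = w j"
  shows "induced_partition t v = induced_partition t w"
  unfolding induced_partition_def using assms by (intro image_cong) auto

text \<open>
  Working with \<^const>\<open>block\<close> turns "\<open>w\<close> induces \<open>P\<close>" into a statement about pairs of positions.
\<close>

lemma induced_partition_eqI: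
  assumes P: "partition_on {1..t} P"
    and w: "\<And>i j. i \<in> {1..t} \<Longrightarrow> j \<in> {1..t} \<Longrightarrow> w i = w j \<longleftrightarrow> block P i = block P j"
  shows "induced_partition t w = P"
proof -
  have "{j \<in> {1..t}. w j = w i} = block P i" if i: "i \<in> {1..t}" for i
  proof -
    have "block P i \<subseteq> {1..t}"
      using block_mem[OF P i] partition_onD1[OF P] by auto
    moreover have "j \<in> block P i \<longleftrightarrow> block P j = block P i" if "j \<in> {1..t}" for j
      using block_eqI[OF P block_mem(1)[OF P i]] block_mem[OF P that] by auto
    ultimately show ?thesis using w[OF _ i] by auto
  qed
  then have "induced_partition t w = block P ` {1..t}"
    unfolding induced_partition_def by (intro image_cong) auto
  then show ?thesis using block_image[OF P] by simp
qed

lemma induced_partition_const: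
  assumes P: "partition_on {1..t} P" and "card P = 1"
  shows "induced_partition t (\<lambda>_. a) = P"
proof (rule induced_partition_eqI[OF P])
  fix i j assume "i \<in> {1..t}" "j \<in> {1..t}"
  then have "block P i \<in> P" "block P j \<in> P" using block_mem[OF P] by auto
  then show "a = a \<longleftrightarrow> block P i = block P j"
    using \<open>card P = 1\<close> by (auto simp: card_1_singleton_iff)
qed

text \<open>
  A partition of \<open>t\<close> points into \<open>t\<close> blocks consists of singletons: the map from points to blocks is
  a surjection between sets of the same size.
\<close>

lemma induced_partition_inj:
  assumes P: "partition_on {1..t} P" and "card P = t" and w: "inj_on w {1..t}"
  shows "induced_partition t w = P"
proof (rule induced_partition_eqI[OF P])
  have "inj_on (block P) {1..t}"
    using \<open>card P = t\<close> block_image[OF P] by (intro eq_card_imp_inj_on) auto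
  then show "w i = w j \<longleftrightarrow> block P i = block P j" if "i \<in> {1..t}" "j \<in> {1..t}" for i j
    using w that by (auto simp: inj_on_eq_iff)
qed

lemma card_partition_on_le:
  assumes "partition_on {1..t} P"
  shows "card P \<le> t"
  using card_image_le[of "{1..t}" "block P"] block_image[OF assms] by simp

text \<open>
  Every injective labelling \<open>f\<close> of the blocks by letters yields the word that writes the letter
  \<open>f X\<close> at all positions of \<open>X\<close>, and different labellings yield different words. The product counts
  the labellings; its truncated differences make it \<open>0\<close> when there are more blocks than letters.
\<close>

lemma card_words_inducing:
  assumes P: "partition_on {1..t} P"
  shows "(\<Prod>i<card P. q - i) \<le> card {w \<in> {1..t} \<rightarrow>\<^sub>E {1..q}. induced_partition t w = P}"
proof -
  let ?W = "{w \<in> {1..t} \<rightarrow>\<^sub>E {1..q}. induced_partition t w = P}"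
  let ?I = "{f \<in> P \<rightarrow>\<^sub>E {1..q}. inj_on f P}"
  let ?g = "\<lambda>f. restrict (\<lambda>i. f (block P i)) {1..t}"
  have finP: "finite P" using block_image[OF P] by (metis finite_atLeastAtMost finite_imageI)
  have "card ?I = (\<Prod>i<card P. q - i)"
    using card_inj_on_subset_funcset[OF finP, of "{1..q}" P] by (simp add: atLeast0LessThan)
  moreover have "card ?I \<le> card ?W"
  proof (rule card_inj_on_le[where f = ?g])
    show "inj_on ?g ?I"
    proof (rule inj_onI)
      fix f h assume f: "f \<in> ?I" and h: "h \<in> ?I" and eq: "?g f = ?g h"
      have "f X = h X" if "X \<in> P" for X
      proof -
        have "X \<in> block P ` {1..t}" using that block_image[OF P] by simp
        then obtain i where "i \<in> {1..t}" "X = block P i" by (elim imageE)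
        then show ?thesis using fun_cong[OF eq, of i] by simp
      qed
      then show "f = h" using f h by (intro PiE_ext[of f P "\<lambda>_. {1..q}" h]) simp_all
    qed
    show "?g ` ?I \<subseteq> ?W"
    proof clarify
      fix f assume f: "f \<in> P \<rightarrow>\<^sub>E {1..q}" and inj: "inj_on f P"
      have "induced_partition t (?g f) = P"
        using block_mem(1)[OF P] inj by (intro induced_partition_eqI[OF P]) (auto simp: inj_on_eq_iff)
      then show "?g f \<in> {1..t} \<rightarrow>\<^sub>E {1..q} \<and> induced_partition t (?g f) = P"
        using f block_mem(1)[OF P] by (auto simp: PiE_iff)
    qed
    show "finite ?W" by (rule finite_subset[of _ "{1..t} \<rightarrow>\<^sub>E {1..q}"]) (auto intro: finite_PiE)
  qed
  ultimately show ?thesis by simp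
qed

text \<open>
  A row whose entries in the columns \<open>s 1, \<dots>, s t\<close> form a word \<open>w\<close> is determined by \<open>w\<close> and by its free
  entries in the other \<open>N - t\<close> columns. In probabilistic terms, the word seen in the
  selected columns of a random row is uniformly distributed.
\<close>

lemma card_rows_inducing:
  assumes s: "inj_on s {1..t}" "s ` {1..t} \<subseteq> {1..N}"
  shows "card {w \<in> {1..t} \<rightarrow>\<^sub>E {1..q}. induced_partition t w = P} * q ^ (N - t)
    \<le> card {\<rho> \<in> {1..N} \<rightarrow>\<^sub>E {1..q}. induced_partition t (\<lambda>j. \<rho> (s j)) = P}"
proof -
  let ?T = "{1..t}" and ?S = "s ` {1..t}"
  let ?W = "{w \<in> ?T \<rightarrow>\<^sub>E {1..q}. induced_partition t w = P}"
  let ?H = "({1..N} - ?S) \<rightarrow>\<^sub>E {1..q}"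
  let ?R = "{\<rho> \<in> {1..N} \<rightarrow>\<^sub>E {1..q}. induced_partition t (\<lambda>j. \<rho> (s j)) = P}"
  let ?g = "\<lambda>(w, h). restrict (\<lambda>c. if c \<in> ?S then w (inv_into ?T s c) else h c) {1..N}"
  have val: "?g (w, h) (s j) = w j" if "j \<in> ?T" for w h j
  proof -
    have "s j \<in> {1..N}" using that s(2) by blast
    then show ?thesis using that s(1) by (simp add: inv_into_f_f)
  qed
  have val': "?g (w, h) c = h c" if "c \<in> {1..N} - ?S" for w h c
    using that by auto
  have "card ?S = t" using card_image[OF s(1)] by simp
  then have "card ({1..N} - ?S) = N - t"
    using s(2) by (simp add: card_Diff_subset)
  then have "card ?H = q ^ (N - t)"
    by (simp add: card_PiE)
  then have "card ?W * q ^ (N - t) = card (?W \<times> ?H)"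
    by (simp add: card_cartesian_product)
  also have "\<dots> \<le> card ?R"
  proof (rule card_inj_on_le[where f = ?g])
    show "inj_on ?g (?W \<times> ?H)"
    proof (rule inj_onI)
      fix x y assume x: "x \<in> ?W \<times> ?H" and y: "y \<in> ?W \<times> ?H" and eq: "?g x = ?g y"
      obtain w h w' h' where xy: "x = (w, h)" "y = (w', h')" by (cases x, cases y)
      have "w j = w' j" if "j \<in> ?T" for j
        using val[OF that, of w h] val[OF that, of w' h'] eq unfolding xy by metis
      then have "w = w'" using x y xy by (intro PiE_ext[of w ?T "\<lambda>_. {1..q}" w']) simp_all
      moreover have "h c = h' c" if "c \<in> {1..N} - ?S" for c
        using val'[OF that, of w h] val'[OF that, of w' h'] eq unfolding xy by metis
      then have "h = h'" using x y xy
        by (intro PiE_ext[of h "{1..N} - ?S" "\<lambda>_. {1..q}" h']) simp_all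
      ultimately show "x = y" using xy by simp
    qed
    show "?g ` (?W \<times> ?H) \<subseteq> ?R"
    proof (rule image_subsetI)
      fix x assume x: "x \<in> ?W \<times> ?H"
      obtain w h where xy: "x = (w, h)" by (cases x)
      have "induced_partition t (\<lambda>j. ?g (w, h) (s j)) = induced_partition t w"
        using val by (intro induced_partition_cong)
      moreover have "?g (w, h) \<in> {1..N} \<rightarrow>\<^sub>E {1..q}"
      proof (rule PiE_I)
        fix c assume c: "c \<in> {1..N}"
        show "?g (w, h) c \<in> {1..q}"
        proof (cases "c \<in> ?S")
          case True
          then obtain j where "j \<in> ?T" "c = s j" by auto
          then show ?thesis using val[of j w h] x xy by auto
        next
          case False
          then show ?thesis using val'[of c w h] x xy c by auto
        qed
      qed auto
      ultimately show "?g x \<in> ?R" using x xy by simp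
    qed
    show "finite ?R" by (rule finite_subset[of _ "{1..N} \<rightarrow>\<^sub>E {1..q}"]) (auto intro: finite_PiE)
  qed
  finally show ?thesis .
qed

section \<open>Arrays by random choice and deletion of columns\<close>

text \<open>
  The columns are selected by arbitrary injections, not just by increasing maps. The requirement
  then survives any renumbering of the columns, so that after a deletion the surviving
  columns may be listed in any order.
\<close>

definition covers :: "nat \<Rightarrow> nat \<Rightarrow> nat set \<Rightarrow> nat set set set \<Rightarrow> (nat \<Rightarrow> nat \<Rightarrow> nat) \<Rightarrow> bool" where
  "covers k t C \<P> A \<longleftrightarrow>
     (\<forall>s P. inj_on s {1..t} \<and> s ` {1..t} \<subseteq> C \<and> P \<in> \<P> \<longrightarrow>
        (\<exists>r\<in>{1..k}. induced_partition t (\<lambda>j. A r (s j)) = P))"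

lemma PiE_Collect_avoiding:
  "{f \<in> I \<rightarrow>\<^sub>E R. \<forall>i\<in>I. \<not> Q (f i)} = I \<rightarrow>\<^sub>E (R - {x \<in> R. Q x})"
  unfolding PiE_def Pi_def by blast

text \<open>
  The rows of a random array are independent: the arrays that miss \<open>P\<close> in the selected columns form
  a product set, each factor of which has relative size at most \<open>1 - m / q ^ t\<close>.
\<close>

lemma card_arrays_missing:
  fixes q t m N k :: nat
  assumes s: "inj_on s {1..t}" "s ` {1..t} \<subseteq> {1..N}"
    and m: "m \<le> card {w \<in> {1..t} \<rightarrow>\<^sub>E {1..q}. induced_partition t w = P}"
    and q: "0 < q"
  shows "real (card {A \<in> {1..k} \<rightarrow>\<^sub>E ({1..N} \<rightarrow>\<^sub>E {1..q}).
            \<forall>r\<in>{1..k}. induced_partition t (\<lambda>j. A r (s j)) \<noteq> P})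
    \<le> (1 - real m / real q ^ t) ^ k * real (card ({1..k} \<rightarrow>\<^sub>E ({1..N} \<rightarrow>\<^sub>E {1..q})))"
proof -
  let ?R = "{1..N} \<rightarrow>\<^sub>E {1..q}"
  let ?G = "{\<rho> \<in> ?R. induced_partition t (\<lambda>j. \<rho> (s j)) = P}"
  have fin: "finite ?R" by (auto intro: finite_PiE)
  have tN: "t \<le> N" using card_mono[OF _ s(2)] card_image[OF s(1)] by simp
  have R: "card ?R = q ^ N" by (simp add: card_PiE)
  have G: "m * q ^ (N - t) \<le> card ?G"
    using card_rows_inducing[OF s, of q P] m by (meson le_trans mult_le_mono1)
  have "real (card (?R - ?G)) = real (card ?R) - real (card ?G)"
    using fin by (subst card_Diff_subset) (auto intro: finite_subset simp: of_nat_diff card_mono)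
  also have "\<dots> \<le> real q ^ N - real m * real q ^ (N - t)"
    using G[THEN of_nat_mono[where 'a = real]] R by simp
  also have "\<dots> = (1 - real m / real q ^ t) * real (card ?R)"
    using q tN R by (simp add: power_diff field_simps)
  finally have *: "real (card (?R - ?G)) \<le> (1 - real m / real q ^ t) * real (card ?R)" .
  have "{A \<in> {1..k} \<rightarrow>\<^sub>E ?R. \<forall>r\<in>{1..k}. induced_partition t (\<lambda>j. A r (s j)) \<noteq> P}
      = {1..k} \<rightarrow>\<^sub>E (?R - ?G)"
    by (rule PiE_Collect_avoiding)
  then have "real (card {A \<in> {1..k} \<rightarrow>\<^sub>E ?R. \<forall>r\<in>{1..k}. induced_partition t (\<lambda>j. A r (s j)) \<noteq> P})
      = real (card (?R - ?G)) ^ k"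
    by (simp add: card_PiE)
  also have "\<dots> \<le> ((1 - real m / real q ^ t) * real (card ?R)) ^ k"
    using * by (intro power_mono) auto
  also have "\<dots> = (1 - real m / real q ^ t) ^ k * real (card ({1..k} \<rightarrow>\<^sub>E ?R))"
    by (simp add: card_PiE power_mult_distrib)
  finally show ?thesis .
qed

text \<open>
  The left-hand side of \<open>few\<close> bounds the average number of misses, that is, of pairs of a column
  selection and a partition that is not induced, over all \<open>k \<times> N\<close> arrays. An array at or
  below the average has at most \<open>N - n\<close> misses, and dropping the first column of each missed
  selection destroys all of them while \<open>n\<close> columns remain.
\<close>

lemma exists_covering_by_deletion:
  fixes q t m N n k :: nat
  assumes \<P>: "finite \<P>"
    and m: "\<And>P. P \<in> \<P> \<Longrightarrow> m \<le> card {w \<in> {1..t} \<rightarrow>\<^sub>E {1..q}. induced_partition t w = P}"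
    and q: "0 < q" "m \<le> q ^ t" and t: "0 < t"
    and few: "real (card \<P>) * real N ^ t * (1 - real m / real q ^ t) ^ k \<le> real N - real n"
  shows "\<exists>A. (\<forall>r\<in>{1..k}. \<forall>c\<in>{1..n}. A r c \<in> {1..q}) \<and> covers k t {1..n} \<P> A"
proof -
  let ?p = "1 - real m / real q ^ t"
  define Arr where "Arr = {1..k} \<rightarrow>\<^sub>E ({1..N} \<rightarrow>\<^sub>E {1..q})"
  define S where "S = {s \<in> {1..t} \<rightarrow>\<^sub>E {1..N}. inj_on s {1..t}}"
  define miss where "miss A x \<longleftrightarrow>
    (\<forall>r\<in>{1..k}. induced_partition t (\<lambda>j. A r (fst x j)) \<noteq> snd x)"
    for A :: "nat \<Rightarrow> nat \<Rightarrow> nat" and x :: "(nat \<Rightarrow> nat) \<times> nat set set"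
  have finArr: "finite Arr" unfolding Arr_def by (auto intro!: finite_PiE)
  have finS: "finite S" unfolding S_def
    by (rule finite_subset[of _ "{1..t} \<rightarrow>\<^sub>E {1..N}"]) (auto intro: finite_PiE)
  have cardS: "card S \<le> N ^ t"
    using card_mono[of "{1..t} \<rightarrow>\<^sub>E {1..N}" S] by (simp add: S_def card_PiE finite_PiE)
  have "Arr \<noteq> {}" unfolding Arr_def using q by (simp add: PiE_eq_empty_iff)
  have p: "0 \<le> ?p" using q by (simp add: divide_le_eq)
  have "\<exists>A\<in>Arr. real (card {x \<in> S \<times> \<P>. miss A x}) \<le> real N - real n"
  proof (rule ccontr)
    assume "\<not> ?thesis"
    then have gt: "\<And>A. A \<in> Arr \<Longrightarrow> real N - real n < real (card {x \<in> S \<times> \<P>. miss A x})"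
      by auto
    have "real (card Arr) * (real N - real n) = (\<Sum>A\<in>Arr. real N - real n)" by simp
    also have "\<dots> < (\<Sum>A\<in>Arr. real (card {x \<in> S \<times> \<P>. miss A x}))"
      using gt finArr \<open>Arr \<noteq> {}\<close> by (intro sum_strict_mono) auto
    \<comment> \<open>linearity of expectation, as double counting of the misses\<close>
    also have "\<dots> = (\<Sum>x\<in>S \<times> \<P>. real (card {A \<in> Arr. miss A x}))"
      using sum.swap_restrict[OF finArr, of "S \<times> \<P>" "\<lambda>_ _. 1::real" miss] finS \<P> by simp
    also have "\<dots> \<le> (\<Sum>x\<in>S \<times> \<P>. ?p ^ k * real (card Arr))"
    proof (rule sum_mono)
      fix x assume "x \<in> S \<times> \<P>"
      then show "real (card {A \<in> Arr. miss A x}) \<le> ?p ^ k * real (card Arr)"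
        unfolding Arr_def miss_def S_def
        using m q by (intro card_arrays_missing) (auto simp: PiE_iff)
    qed
    also have "\<dots> = real (card S) * real (card \<P>) * ?p ^ k * real (card Arr)"
      by (simp add: card_cartesian_product)
    also have "\<dots> \<le> real N ^ t * real (card \<P>) * ?p ^ k * real (card Arr)"
      using cardS[THEN of_nat_mono[where 'a = real]] p by (intro mult_right_mono) auto
    also have "\<dots> \<le> (real N - real n) * real (card Arr)"
      using few by (intro mult_right_mono) (auto simp: mult_ac)
    finally show False by (simp add: mult.commute)
  qed
  then obtain A where A: "A \<in> Arr"
    and bad: "real (card {x \<in> S \<times> \<P>. miss A x}) \<le> real N - real n" by auto
  define B where "B = {x \<in> S \<times> \<P>. miss A x}"
  have finB: "finite B" unfolding B_def using finS \<P> by simp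
  \<comment> \<open>one column per miss; the first one exists since \<open>t > 0\<close>\<close>
  define D where "D = (\<lambda>x. fst x 1) ` B"
  have "card D + n \<le> N"
    using card_image_le[OF finB, of "\<lambda>x. fst x 1"] bad unfolding D_def B_def by linarith
  then have "n \<le> card ({1..N} - D)"
    using diff_card_le_card_Diff[of D "{1..N}"] finB unfolding D_def by simp
  then obtain C where C: "C \<subseteq> {1..N} - D" "card C = n" by (meson obtain_subset_with_card_n)
  then have "finite C" using finite_subset by blast
  then obtain e where e: "bij_betw e {1..n} C"
    using C(2) ex_bij_betw_nat_finite_1 by blast
  have "covers k t {1..n} \<P> (\<lambda>r c. A r (e c))"
    unfolding covers_def
  proof (intro allI impI, elim conjE)
    fix s P assume s: "inj_on s {1..t}" "s ` {1..t} \<subseteq> {1..n}" and P: "P \<in> \<P>"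
    \<comment> \<open>restricted because the selections counted in \<open>S\<close> are extensional\<close>
    let ?s = "restrict (\<lambda>j. e (s j)) {1..t}"
    have sC: "?s j \<in> C" if "j \<in> {1..t}" for j
    proof -
      have "s j \<in> {1..n}" using that s(2) by blast
      then show ?thesis using bij_betw_apply[OF e] that by simp
    qed
    have "inj_on ?s {1..t}"
      using comp_inj_on[OF s(1) inj_on_subset[OF bij_betw_imp_inj_on[OF e] s(2)]]
      by (simp add: inj_on_restrict_eq o_def)
    moreover have "e (s j) \<in> {1..N}" if "j \<in> {1..t}" for j
      using sC[OF that] C(1) that by auto
    ultimately have "?s \<in> S" unfolding S_def by simp
    moreover have "(?s, P) \<notin> B"
      using sC[of 1] C(1) t unfolding D_def by force
    ultimately have "\<not> miss A (?s, P)" unfolding B_def using P by simp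
    then obtain r where "r \<in> {1..k}" "induced_partition t (\<lambda>j. A r (?s j)) = P"
      unfolding miss_def by auto
    moreover have "induced_partition t (\<lambda>j. A r (?s j)) = induced_partition t (\<lambda>j. A r (e (s j)))"
      by (rule induced_partition_cong) simp
    ultimately show "\<exists>r\<in>{1..k}. induced_partition t (\<lambda>j. A r (e (s j))) = P" by auto
  qed
  moreover have "A r (e c) \<in> {1..q}" if "r \<in> {1..k}" "c \<in> {1..n}" for r c
  proof -
    have "A r \<in> {1..N} \<rightarrow>\<^sub>E {1..q}"
      using A that(1) unfolding Arr_def by (rule PiE_mem)
    moreover have "e c \<in> {1..N}"
      using bij_betw_apply[OF e that(2)] C(1) by auto
    ultimately show ?thesis by (rule PiE_mem)
  qed
  ultimately show ?thesis by (intro exI[of _ "\<lambda>r c. A r (e c)"]) auto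
qed

lemma covers_add_row:
  assumes "covers k t C \<P> A"
    and "\<And>s Q. inj_on s {1..t} \<Longrightarrow> s ` {1..t} \<subseteq> C \<Longrightarrow> Q \<in> \<Q> \<Longrightarrow>
      induced_partition t (\<lambda>j. u (s j)) = Q"
  shows "covers (Suc k) t C (\<P> \<union> \<Q>) (A(Suc k := u))"
  unfolding covers_def
proof (intro allI impI, elim conjE)
  fix s P assume s: "inj_on s {1..t}" "s ` {1..t} \<subseteq> C" and P: "P \<in> \<P> \<union> \<Q>"
  show "\<exists>r\<in>{1..Suc k}. induced_partition t (\<lambda>j. (A(Suc k := u)) r (s j)) = P"
  proof (cases "P \<in> \<P>")
    case True
    then obtain r where "r \<in> {1..k}" "induced_partition t (\<lambda>j. A r (s j)) = P"
      using assms(1) s unfolding covers_def by blast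
    then show ?thesis by (intro bexI[of _ r]) auto
  next
    case False
    then show ?thesis using assms(2)[OF s] P by (intro bexI[of _ "Suc k"]) auto
  qed
qed

lemma k0_le:
  assumes "\<forall>r\<in>{1..k}. \<forall>c\<in>{1..n}. A r c \<in> {1..d}"
    and "covers k t {1..n} {P. partition_on {1..t} P} A"
  shows "k0 n t d \<le> k"
proof -
  have "covering_array_set_partitions k n t d A"
    using assms strict_mono_on_imp_inj_on
    unfolding covering_array_set_partitions_def covers_def by blast
  then show ?thesis unfolding k0_def by (intro Least_le) blast
qed

section \<open>Strength four\<close>

text \<open>
  These are the partitions left to the random rows over \<open>q\<close> letters. The one-block partition has to
  be set apart because only \<open>q\<close> words induce it, which would dominate the probability of a miss.
\<close>

definition middle_partitions :: "nat \<Rightarrow> nat set set set" where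
  "middle_partitions q = {P. partition_on {1..4} P \<and> 2 \<le> card P \<and> card P \<le> q}"

lemma finite_middle_partitions: "finite (middle_partitions q)"
  by (rule finite_subset[OF _ finitely_many_partition_on[of "{1..4}"]])
     (auto simp: middle_partitions_def)

text \<open>
  Deletion from \<open>2n\<close> columns: the condition \<open>F (2n) ^ 4 p ^ k \<le> 2n - n\<close> is \<open>few\<close> multiplied by \<open>n\<close>.
\<close>

lemma exists_covering_middle:
  assumes q: "q = 3 \<or> q = 4"
    and few: "16 * real (card (middle_partitions q)) * real n ^ 3
        * (1 - real (q * (q - 1)) / real q ^ 4) ^ k \<le> 1"
  shows "\<exists>A. (\<forall>r\<in>{1..k}. \<forall>c\<in>{1..n}. A r c \<in> {1..q}) \<and> covers k 4 {1..n} (middle_partitions q) A"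
proof (rule exists_covering_by_deletion[where m = "q * (q - 1)" and N = "2 * n"])
  fix P assume P: "P \<in> middle_partitions q"
  then have "card P = 2 \<or> card P = 3 \<or> q = 4 \<and> card P = 4"
    using q by (auto simp: middle_partitions_def)
  then have "q * (q - 1) \<le> (\<Prod>i<card P. q - i)"
    using q by (auto simp: eval_nat_numeral)
  then show "q * (q - 1) \<le> card {w \<in> {1..4} \<rightarrow>\<^sub>E {1..q}. induced_partition 4 w = P}"
    using card_words_inducing[of 4 P q] P by (auto simp: middle_partitions_def)
next
  let ?p = "1 - real (q * (q - 1)) / real q ^ 4"
  have "real n * (16 * real (card (middle_partitions q)) * real n ^ 3 * ?p ^ k) \<le> real n * 1"
    using few by (intro mult_left_mono) auto
  then show "real (card (middle_partitions q)) * real (2 * n) ^ 4 * ?p ^ k \<le> real (2 * n) - real n"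
    by (simp add: power_mult_distrib power4_eq_xxxx power3_eq_cube mult_ac)
qed (use q finite_middle_partitions in auto)

lemma card_partition_on_pos:
  assumes "partition_on {1..4::nat} P"
  shows "0 < card P"
proof -
  have "finite P" using block_image[OF assms] by (metis finite_atLeastAtMost finite_imageI)
  moreover have "P \<noteq> {}" using partition_onD1[OF assms] by auto
  ultimately show ?thesis by (simp add: card_gt_0_iff)
qed

lemma k0_4_4_le:
  assumes "16 * real (card (middle_partitions 4)) * real n ^ 3 * (244/256) ^ k \<le> 1"
  shows "k0 n 4 4 \<le> k + 2"
proof -
  obtain A where A: "\<forall>r\<in>{1..k}. \<forall>c\<in>{1..n}. A r c \<in> {1..4}"
    "covers k 4 {1..n} (middle_partitions 4) A"
    using exists_covering_middle[of 4 n k] assms by auto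
  let ?A = "A(Suc k := (\<lambda>_. 1))"
  have "covers (Suc k) 4 {1..n} (middle_partitions 4 \<union> {P. partition_on {1..4} P \<and> card P = 1}) ?A"
    using A(2) by (intro covers_add_row induced_partition_const) auto
  moreover have "middle_partitions 4 \<union> {P. partition_on {1..4} P \<and> card P = 1}
      = {P. partition_on {1..4} P}"
  proof -
    have "card P = 1 \<or> 2 \<le> card P \<and> card P \<le> 4" if "partition_on {1..4} P" for P :: "nat set set"
      using card_partition_on_le[OF that] card_partition_on_pos[OF that] by linarith
    then show ?thesis by (auto simp: middle_partitions_def)
  qed
  ultimately have "k0 n 4 4 \<le> Suc k"
    using A(1) by (intro k0_le[of _ _ ?A]) (auto simp: le_Suc_eq)
  then show ?thesis by simp
qed

lemma k0_4_n_le: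
  assumes "16 * real (card (middle_partitions 3)) * real n ^ 3 * (75/81) ^ k \<le> 1" "3 \<le> n"
  shows "k0 n 4 n \<le> k + 2"
proof -
  obtain A where A: "\<forall>r\<in>{1..k}. \<forall>c\<in>{1..n}. A r c \<in> {1..3}"
    "covers k 4 {1..n} (middle_partitions 3) A"
    using exists_covering_middle[of 3 n k] assms by auto
  let ?A = "A(Suc k := (\<lambda>_. 1), Suc (Suc k) := (\<lambda>c. c))"
  have "covers (Suc (Suc k)) 4 {1..n} (middle_partitions 3
      \<union> {P. partition_on {1..4} P \<and> card P = 1} \<union> {P. partition_on {1..4} P \<and> card P = 4}) ?A"
    using A(2)
    by (intro covers_add_row induced_partition_const induced_partition_inj) auto
  moreover have "middle_partitions 3 \<union> {P. partition_on {1..4} P \<and> card P = 1}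
      \<union> {P. partition_on {1..4} P \<and> card P = 4} = {P. partition_on {1..4} P}"
  proof -
    have "card P = 1 \<or> 2 \<le> card P \<and> card P \<le> 3 \<or> card P = 4" if "partition_on {1..4} P" for P :: "nat set set"
      using card_partition_on_le[OF that] card_partition_on_pos[OF that] by linarith
    then show ?thesis by (auto simp: middle_partitions_def)
  qed
  moreover have "\<forall>r\<in>{1..Suc (Suc k)}. \<forall>c\<in>{1..n}. ?A r c \<in> {1..n}"
  proof -
    have "A r c \<in> {1..n}" if "r \<in> {1..k}" "c \<in> {1..n}" for r c
    proof -
      have "A r c \<in> {1..3}" using A(1) that by blast
      then show ?thesis using assms(2) by simp
    qed
    then show ?thesis using assms(2) by (auto simp: le_Suc_eq)
  qed
  ultimately have "k0 n 4 n \<le> Suc (Suc k)"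
    by (intro k0_le[of _ _ ?A]) auto
  then show ?thesis by simp
qed

section \<open>Asymptotics and numerical values\<close>

text \<open>
  The decay condition holds once \<open>k \<ge> log b (K n ^ 3) = 3 lg n / lg b + O(1)\<close>. With \<open>K + 1\<close> in place of \<open>K\<close> the
  logarithm is defined and nonnegative also for small \<open>K\<close>. The additive constant, called \<open>D\<close> in
  the proof, becomes the error term \<open>\<epsilon> n = D lg b / (3 lg n)\<close>.
\<close>

lemma log_bound_from_decay:
  fixes f :: "nat \<Rightarrow> nat" and b K :: real
  assumes b: "1 < b" and K: "0 \<le> K"
    and f: "\<And>n k. N \<le> n \<Longrightarrow> K * real n ^ 3 * (1 / b) ^ k \<le> 1 \<Longrightarrow> f n \<le> k + 2"
  shows "\<exists>\<epsilon> :: nat \<Rightarrow> real. \<epsilon> \<longlonglongrightarrow> 0 \<and>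
    (\<forall>\<^sub>F n in sequentially. real (f n) \<le> 3 / log 2 b * (1 + \<epsilon> n) * log 2 (real n))"
proof -
  define L where "L = log 2 b"
  have L: "0 < L" using b by (simp add: L_def)
  \<comment> \<open>one unit of the \<open>3\<close> pays for the ceiling, the other two for the additional rows in \<open>f\<close>\<close>
  define D where "D = log 2 (K + 1) / L + 3"
  define \<epsilon> where "\<epsilon> n = D * L / 3 / log 2 (real n)" for n :: nat
  have "(\<lambda>n. D * L / 3 * ln 2 / ln (real n)) \<longlonglongrightarrow> 0"
    by (intro tendsto_divide_0[OF tendsto_const] filterlim_at_top_imp_at_infinity
        filterlim_compose[OF ln_at_top filterlim_real_sequentially])
  then have "\<epsilon> \<longlonglongrightarrow> 0" unfolding \<epsilon>_def log_def by simp
  moreover have "real (f n) \<le> 3 / L * (1 + \<epsilon> n) * log 2 (real n)" if n: "n \<ge> max 2 N" for n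
  proof -
    define x where "x = (log 2 (K + 1) + 3 * log 2 (real n)) / L"
    have x: "0 \<le> x" unfolding x_def using L K n by simp
    define k where "k = nat \<lceil>x\<rceil>"
    have k: "x \<le> real k" "real k \<le> x + 1" unfolding k_def using x by linarith+
    have lb: "b powr x = (K + 1) * real n ^ 3"
    proof -
      have "b = 2 powr L" unfolding L_def using b by simp
      then have "b powr x = 2 powr (L * x)" by (simp add: powr_powr)
      also have "L * x = log 2 ((K + 1) * real n ^ 3)"
        unfolding x_def using L K n by (simp add: log_mult log_nat_power)
      finally show ?thesis using K n by simp
    qed
    have "K * real n ^ 3 \<le> b powr x" unfolding lb by (simp add: algebra_simps)
    also have "\<dots> \<le> b powr real k" using b k by simp
    also have "\<dots> = b ^ k" using b by (simp add: powr_realpow)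
    finally have "K * real n ^ 3 * (1 / b) ^ k \<le> 1"
      using b by (simp add: power_divide)
    then have "real (f n) \<le> real k + 2" using f[of n k] n by linarith
    also have "\<dots> \<le> x + 3" using k by simp
    also have "\<dots> = 3 / L * log 2 (real n) + D"
      unfolding x_def D_def using L by (simp add: field_simps)
    also have "\<dots> = 3 / L * (1 + \<epsilon> n) * log 2 (real n)"
    proof -
      have "log 2 (real n) > 0" using n by simp
      then show ?thesis unfolding \<epsilon>_def using L by (simp add: field_simps)
    qed
    finally show ?thesis .
  qed
  then have "\<forall>\<^sub>F n in sequentially. real (f n) \<le> 3 / L * (1 + \<epsilon> n) * log 2 (real n)"
    by (rule eventually_sequentiallyI)
  ultimately show ?thesis unfolding L_def by blast
qed

theorem theorem2p6:
  shows "(\<exists>\<epsilon> :: nat \<Rightarrow> real. \<epsilon> \<longlonglongrightarrow> 0 \<and>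
            (\<forall>\<^sub>F n in sequentially.
               real (k0 n 4 n) \<le> 3 / log 2 (81/75) * (1 + \<epsilon> n) * log 2 (real n))) \<and>
         (\<exists>\<epsilon> :: nat \<Rightarrow> real. \<epsilon> \<longlonglongrightarrow> 0 \<and>
            (\<forall>\<^sub>F n in sequentially.
               real (k0 n 4 4) \<le> 3 / log 2 (256/244) * (1 + \<epsilon> n) * log 2 (real n))) \<and>
         (27.019 :: real) \<le> 3 / log 2 (81/75) \<and> 3 / log 2 (81/75) < (27.020 :: real) \<and>
         (43.313 :: real) \<le> 3 / log 2 (256/244) \<and> 3 / log 2 (256/244) < (43.314 :: real)"
proof (intro conjI)
  show "\<exists>\<epsilon> :: nat \<Rightarrow> real. \<epsilon> \<longlonglongrightarrow> 0 \<and>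
            (\<forall>\<^sub>F n in sequentially.
               real (k0 n 4 n) \<le> 3 / log 2 (81/75) * (1 + \<epsilon> n) * log 2 (real n))"
    by (rule log_bound_from_decay[where N = 3 and K = "16 * real (card (middle_partitions 3))"])
       (use k0_4_n_le in auto)
  show "\<exists>\<epsilon> :: nat \<Rightarrow> real. \<epsilon> \<longlonglongrightarrow> 0 \<and>
            (\<forall>\<^sub>F n in sequentially.
               real (k0 n 4 4) \<le> 3 / log 2 (256/244) * (1 + \<epsilon> n) * log 2 (real n))"
    by (rule log_bound_from_decay[where N = 0 and K = "16 * real (card (middle_partitions 4))"])
       (use k0_4_4_le in auto)
next
  \<comment> \<open>partial sums of \<open>ln x = 2 artanh ((x - 1) / (x + 1))\<close>\<close>
  have ln2: "0.693147180 \<le> ln (2::real)" "ln (2::real) \<le> 0.693147181"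
    using ln_approx_bounds[of 2 9] by (simp_all add: eval_nat_numeral)
  have ln1: "0.07696104 \<le> ln (81/75::real)" "ln (81/75::real) \<le> 0.07696105"
    using ln_approx_bounds[of "81/75" 3] by (simp_all add: eval_nat_numeral)
  have ln2': "0.04800921 \<le> ln (256/244::real)" "ln (256/244::real) \<le> 0.04800922"
    using ln_approx_bounds[of "256/244" 3] by (simp_all add: eval_nat_numeral)
  have log_eq: "3 / log 2 b = 3 * ln 2 / ln b" for b :: real by (simp add: log_def)
  show "27.019 \<le> 3 / log 2 (81/75::real)" "3 / log 2 (81/75) < (27.020::real)"
    unfolding log_eq using ln2 ln1 by (simp_all add: field_simps)
  show "43.313 \<le> 3 / log 2 (256/244::real)" "3 / log 2 (256/244) < (43.314::real)"
    unfolding log_eq using ln2 ln2' by (simp_all add: field_simps)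
qed

end
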